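(* Let $C$ be a proper closed cone in $\mathbb{R}^n$ and let $f: \operatorname{int} C \to \operatorname{int} C$ be order-preserving and homogeneous of degree one with cone spectral radius $\rho(f) = \rho$. If $C$ is a polyhedral cone and $x \in \operatorname{int} C$, then there is a $w \in C^* \setminus \{0\}$ such that $\langle f^k(x), w\rangle \le \rho^k \langle x, w\rangle$ for all $k \in \mathbb{N}$.
   Context: Let $n\ge 1$. A closed cone $C \subset \mathbb{R}^n$ is a closed convex set with $C \cap (-C) = \{0\}$ and $\lambda C \subseteq C$ for all $\lambda \ge 0$. It is a proper closed cone if it has nonempty interior $\operatorname{int} C$. The dual cone is $C^* = \{x \in \mathbb{R}^n : \langle x, y\rangle \ge 0 \text{ for all } y \in C\}$, with $\langle\cdot,\cdot\rangle$ the standard inner product. A cone is polyhedral if it is the intersection of finitely many closed half-spaces $\{x : \langle x,u\rangle \ge 0\}$. The cone defines a partial order on $\mathbb{R}^n$ by $x \le y$ if and only if $y - x \in C$. A map $f: \operatorname{int} C \to \operatorname{int} C$ is order-preserving if $x \le y$ implies $f(x) \le f(y)$, and homogeneous of degree one if $f(\lambda x) = \lambda f(x)$ for all $\lambda > 0$ and $x \in \operatorname{int} C$. For such $f$, the cone spectral radius is $\rho(f) = \lim_{k\to\infty} \|f^k(x)\|^{1/k}$ for any $x \in \operatorname{int} C$, where $f^k$ is the $k$-th iterate of $f$; the limit exists and is independent of $x \in \operatorname{int} C$. *)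

theory Defs
  imports "HOL-Analysis.Analysis"
begin

definition closed_cone :: "(real ^ 'n) set \<Rightarrow> bool" where
  "closed_cone C \<longleftrightarrow> closed C \<and> convex C \<and> cone C \<and> C \<inter> uminus ` C = {0}"

definition proper_closed_cone :: "(real ^ 'n) set \<Rightarrow> bool" where
  "proper_closed_cone C \<longleftrightarrow> closed_cone C \<and> interior C \<noteq> {}"

definition dual_cone :: "(real ^ 'n) set \<Rightarrow> (real ^ 'n) set" where
  "dual_cone C = {x. \<forall>y\<in>C. x \<bullet> y \<ge> 0}"

definition polyhedral_cone :: "(real ^ 'n) set \<Rightarrow> bool" where
  "polyhedral_cone C \<longleftrightarrow> closed_cone C \<and>
     (\<exists>U. finite U \<and> C = (\<Inter>u\<in>U. {x. x \<bullet> u \<ge> 0}))"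

definition cone_le :: "(real ^ 'n) set \<Rightarrow> real ^ 'n \<Rightarrow> real ^ 'n \<Rightarrow> bool" where
  "cone_le C x y \<longleftrightarrow> y - x \<in> C"

(* Maps int C \<rightarrow> int C are total functions on the whole space; only their
   values on interior C are constrained or used. *)

definition cone_order_preserving ::
  "(real ^ 'n) set \<Rightarrow> (real ^ 'n \<Rightarrow> real ^ 'n) \<Rightarrow> bool" where
  "cone_order_preserving C f \<longleftrightarrow> monotone_on (interior C) (cone_le C) (cone_le C) f"

definition cone_homogeneous ::
  "(real ^ 'n) set \<Rightarrow> (real ^ 'n \<Rightarrow> real ^ 'n) \<Rightarrow> bool" where
  "cone_homogeneous C f \<longleftrightarrow> (\<forall>c>0. \<forall>x\<in>interior C. f (c *\<^sub>R x) = c *\<^sub>R f x)"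

(* The common value of the limits for all x in the interior. It is meaningful when C is
   a proper closed cone and f is an order-preserving homogeneous self-map of interior C:
   then every limit exists and none depends on x. The exponent 1 / real 0 = 0 at k = 0
   does not affect the limit. *)
definition cone_spectral_radius ::
  "(real ^ 'n) set \<Rightarrow> (real ^ 'n \<Rightarrow> real ^ 'n) \<Rightarrow> real" where
  "cone_spectral_radius C f =
     (THE r. \<forall>x\<in>interior C. (\<lambda>k. norm ((f ^^ k) x) powr (1 / real k)) \<longlonglongrightarrow> r)"

end

theory Submission
  imports Defs
begin

text \<open>The vector \<open>w\<close> can be chosen among the finitely many nonzero normals \<open>u\<close> of the half-spaces
  that define the cone. Let \<open>m\<^sub>n\<close> be the minimum over these normals of
  \<open>(f\<^sup>n x \<bullet> u) / (x \<bullet> u)\<close>, that is, the largest \<open>m\<close> with \<open>m x \<le> f\<^sup>n x\<close>. Since \<open>m\<^sub>n\<close> is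
  at most a constant times the norm of \<open>f\<^sup>n x\<close>, the quotient \<open>m\<^sub>n / R\<^sup>n\<close> tends to zero for every
  \<open>R > \<rho>\<close> and so has record lows at arbitrarily large \<open>n\<close>. For such an \<open>n\<close> let \<open>u\<close> attain the
  minimum. For \<open>k \<le> n\<close>, applying \<open>f\<^sup>k\<close> to \<open>m\<^sub>n\<^sub>-\<^sub>k x \<le> f\<^sup>n\<^sup>-\<^sup>k x\<close> gives
  \<open>f\<^sup>k x \<bullet> u \<le> (m\<^sub>n / m\<^sub>n\<^sub>-\<^sub>k) (x \<bullet> u)\<close> (\<open>iterate_at_minimiser\<close>), and the record property bounds the
  factor by \<open>R\<^sup>k\<close>. As there are only finitely many normals, one of them serves for all \<open>k\<close> and for
  \<open>R\<close> tending to \<open>\<rho>\<close>; this is \<open>normal_with_bounded_growth\<close>.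

  The argument uses that the norms of the iterates really have the growth rate \<open>\<rho>\<close>
  (\<open>norm_iterate_growth_rate\<close>). This holds by Fekete's lemma: an interior point is an order unit, so
  the size of \<open>f\<^sup>n x\<close> is submultiplicative in \<open>n\<close> up to a constant, and two interior points bound
  each other up to constants, so their orbits grow at the same rate.\<close>

section \<open>Growth rates of positive sequences\<close>

lemma const_powr_inverse_tendsto_1:
  fixes B :: real
  assumes "B > 0"
  shows "(\<lambda>n. B powr (1 / real n)) \<longlonglongrightarrow> 1"
proof -
  have "(\<lambda>n. B powr (1 / real n)) \<longlonglongrightarrow> B powr 0"
    using assms by (intro tendsto_powr lim_1_over_n tendsto_const) auto
  then show ?thesis using assms by simp
qed

lemma growth_rate_comparable:
  fixes g h :: "nat \<Rightarrow> real"
  assumes B: "B > 0" and h: "\<And>n. h n > 0"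
    and gh: "\<And>n. g n \<le> B * h n" and hg: "\<And>n. h n \<le> B * g n"
    and lim: "(\<lambda>n. h n powr (1 / real n)) \<longlonglongrightarrow> r"
  shows "(\<lambda>n. g n powr (1 / real n)) \<longlonglongrightarrow> r"
proof (rule tendsto_sandwich)
  have g: "g n > 0" for n
    using h[of n] hg[of n] B by (smt (verit) mult_pos_neg mult_zero_right zero_less_mult_pos)
  show "\<forall>\<^sub>F n in sequentially. (1 / B) powr (1 / real n) * h n powr (1 / real n) \<le> g n powr (1 / real n)"
  proof (intro always_eventually allI)
    fix n
    have "(1 / B) * h n \<le> g n" using hg[of n] B by (simp add: field_simps)
    then have "((1 / B) * h n) powr (1 / real n) \<le> g n powr (1 / real n)"
      using B h[of n] by (intro powr_mono2) auto
    then show "(1 / B) powr (1 / real n) * h n powr (1 / real n) \<le> g n powr (1 / real n)"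
      using B h[of n] by (subst (asm) powr_mult) auto
  qed
  show "\<forall>\<^sub>F n in sequentially. g n powr (1 / real n) \<le> B powr (1 / real n) * h n powr (1 / real n)"
  proof (intro always_eventually allI)
    fix n
    have "g n powr (1 / real n) \<le> (B * h n) powr (1 / real n)"
      using g[of n] gh[of n] by (intro powr_mono2) auto
    then show "g n powr (1 / real n) \<le> B powr (1 / real n) * h n powr (1 / real n)"
      using B h[of n] by (subst (asm) powr_mult) auto
  qed
  show "(\<lambda>n. (1 / B) powr (1 / real n) * h n powr (1 / real n)) \<longlonglongrightarrow> r"
    using tendsto_mult[OF const_powr_inverse_tendsto_1[of "1 / B"] lim] B by simp
  show "(\<lambda>n. B powr (1 / real n) * h n powr (1 / real n)) \<longlonglongrightarrow> r"
    using tendsto_mult[OF const_powr_inverse_tendsto_1[OF B] lim] by simp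
qed

text \<open>This is the multiplicative form of Fekete's lemma. A bound \<open>b m \<le> q ^ m\<close> at a single
  index propagates by submultiplicativity to \<open>b n \<le> B * q ^ n\<close> for all \<open>n\<close>, so that the
  infimum of the roots is also their limit.\<close>

lemma submultiplicative_growth_rate:
  fixes b :: "nat \<Rightarrow> real"
  assumes pos: "\<And>n. b n > 0" and sub: "\<And>m n. b (m + n) \<le> b m * b n"
  shows "\<exists>r. (\<lambda>n. b n powr (1 / real n)) \<longlonglongrightarrow> r"
proof -
  define c where "c n = b n powr (1 / real n)" for n
  define r where "r = Inf (c ` {1..})"
  have bdd: "bdd_below (c ` {1..})"
    by (rule bdd_belowI[of _ 0]) (auto simp: c_def)
  have r_le: "r \<le> c n" if "n \<ge> 1" for n
    unfolding r_def using that bdd by (intro cInf_lower) auto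
  have "c \<longlonglongrightarrow> r"
  proof (rule order_tendstoI)
    fix a assume "a < r"
    then show "\<forall>\<^sub>F n in sequentially. a < c n"
      by (intro eventually_sequentiallyI[of 1]) (use r_le in fastforce)
  next
    fix a assume a: "r < a"
    then obtain m where m: "m \<ge> 1" "c m < a"
      unfolding r_def using cInf_lessD[of "c ` {1..}" a] by fastforce
    then obtain q where q: "c m < q" "q < a" using dense by blast
    have "c m > 0" using pos[of m] by (simp add: c_def)
    then have q0: "q > 0" using q by simp
    have "b m = c m ^ m"
      using pos[of m] m(1) by (simp add: c_def powr_powr flip: powr_realpow)
    then have bm: "b m \<le> q ^ m" using q \<open>c m > 0\<close> by (simp add: power_mono)
    \<comment> \<open>Large enough for the residues modulo \<open>m\<close>, the base cases of the induction below.\<close>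
    define B where "B = (\<Sum>j<m. b j / q ^ j)"
    have B: "B > 0" unfolding B_def using m pos q0
      by (intro sum_pos) (auto simp: lessThan_empty_iff)
    have bound: "b n \<le> B * q ^ n" for n
    proof (induction n rule: less_induct)
      case (less n)
      show ?case
      proof (cases "n < m")
        case True
        have "b n / q ^ n \<le> B"
          unfolding B_def using True pos q0
          by (intro member_le_sum) (auto intro: less_imp_le)
        then show ?thesis using q0 by (simp add: field_simps)
      next
        case False
        have "b n \<le> b m * b (n - m)" using sub[of m "n - m"] False by simp
        also have "\<dots> \<le> q ^ m * (B * q ^ (n - m))"
          using bm less[of "n - m"] False m pos[of "n - m"] q0
          by (intro mult_mono) (auto intro: less_imp_le)
        also have "\<dots> = B * q ^ n" using False by (simp flip: power_add)
        finally show ?thesis .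
      qed
    qed
    have "(\<lambda>n. B powr (1 / real n) * q) \<longlonglongrightarrow> 1 * q"
      by (intro tendsto_mult const_powr_inverse_tendsto_1 B tendsto_const)
    then have "\<forall>\<^sub>F n in sequentially. B powr (1 / real n) * q < a"
      by (rule order_tendstoD(2)) (use q in simp)
    then show "\<forall>\<^sub>F n in sequentially. c n < a"
      using eventually_ge_at_top[of 1]
    proof eventually_elim
      case (elim n)
      have "c n \<le> (B * q ^ n) powr (1 / real n)"
        unfolding c_def using pos[of n] bound[of n] by (intro powr_mono2) auto
      also have "\<dots> = B powr (1 / real n) * (q ^ n) powr (1 / real n)"
        using B q0 by (subst powr_mult) auto
      also have "(q ^ n) powr (1 / real n) = q"
        using q0 elim(2) by (simp add: powr_powr flip: powr_realpow)
      finally show ?case using elim by simp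
    qed
  qed
  then show ?thesis unfolding c_def by blast
qed

lemma growth_rate_below_ratio_tendsto_0:
  fixes g :: "nat \<Rightarrow> real"
  assumes g: "\<And>n. g n \<ge> 0" and lim: "(\<lambda>n. g n powr (1 / real n)) \<longlonglongrightarrow> r"
    and r: "r \<ge> 0" "r < R"
  shows "(\<lambda>n. g n / R ^ n) \<longlonglongrightarrow> 0"
proof (rule tendsto_sandwich)
  define q where "q = (r + R) / 2"
  have q: "r < q" "q < R" "0 < q" using r by (auto simp: q_def)
  show "\<forall>\<^sub>F n in sequentially. 0 \<le> g n / R ^ n" using g r by (simp add: always_eventually)
  have "\<forall>\<^sub>F n in sequentially. g n powr (1 / real n) < q"
    using lim q(1) by (rule order_tendstoD(2))
  then show "\<forall>\<^sub>F n in sequentially. g n / R ^ n \<le> (q / R) ^ n"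
    using eventually_ge_at_top[of 1]
  proof eventually_elim
    case (elim n)
    have "g n = (g n powr (1 / real n)) ^ n"
    proof (cases "g n = 0")
      case False
      then show ?thesis using g[of n] elim(2) by (simp add: powr_powr flip: powr_realpow)
    qed (use elim in simp)
    also have "\<dots> \<le> q ^ n" using elim(1) by (intro power_mono) auto
    finally show ?case using r by (simp add: power_divide divide_right_mono)
  qed
  show "(\<lambda>n. (q / R) ^ n) \<longlonglongrightarrow> 0" using q r by (intro LIMSEQ_realpow_zero) auto
qed simp

text \<open>A positive sequence tending to zero has record lows beyond every index: the first term
  below all of the initial ones is such a record.\<close>

lemma record_low_exists:
  fixes h :: "nat \<Rightarrow> real"
  assumes pos: "\<And>n. h n > 0" and lim: "h \<longlonglongrightarrow> 0"
  shows "\<exists>n\<ge>N. \<forall>j\<le>n. h n \<le> h j"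
proof -
  define \<delta> where "\<delta> = Min (h ` {..N})"
  have \<delta>: "\<delta> > 0" unfolding \<delta>_def using pos by (subst Min_gr_iff) auto
  have \<delta>_le: "\<delta> \<le> h j" if "j \<le> N" for j unfolding \<delta>_def using that by auto
  define n where "n = (LEAST n. h n < \<delta>)"
  have "\<exists>n. h n < \<delta>"
    using order_tendstoD(2)[OF lim \<delta>] by (auto simp: eventually_sequentially)
  then have n: "h n < \<delta>" unfolding n_def by (rule LeastI_ex)
  have "n \<ge> N" using \<delta>_le[of n] n by linarith
  moreover have "h n \<le> h j" if "j \<le> n" for j
  proof (cases "j = n")
    case False
    then have "\<not> h j < \<delta>" using that unfolding n_def by (intro not_less_Least) auto
    then show ?thesis using n by simp
  qed simp
  ultimately show ?thesis by blast
qed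

section \<open>Order-preserving homogeneous maps on a polyhedral cone\<close>

text \<open>The cone is given by finitely many nonzero normals \<open>V\<close>, so that \<open>x \<le> y\<close> is compared
  coordinate by coordinate in the values \<open>x \<bullet> u\<close> for \<open>u \<in> V\<close>. These coordinates determine
  a vector because the cone is pointed.\<close>

locale polyhedral_order_map =
  fixes C V :: "(real ^ 'n) set" and f :: "real ^ 'n \<Rightarrow> real ^ 'n"
  assumes finite_V: "finite V" and zero_V: "0 \<notin> V"
    and C_eq: "C = {z. \<forall>u\<in>V. 0 \<le> z \<bullet> u}"
    and pointed: "C \<inter> uminus ` C = {0}"
    and maps: "f ` interior C \<subseteq> interior C"
    and mono: "cone_order_preserving C f"
    and hom: "cone_homogeneous C f"
begin

lemma eq_0_if_orthogonal:
  assumes "\<And>u. u \<in> V \<Longrightarrow> z \<bullet> u = 0"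
  shows "z = 0"
proof -
  have "z \<in> C" "- z \<in> C" using assms by (auto simp: C_eq)
  then have "z \<in> C \<inter> uminus ` C" by (metis IntI image_eqI minus_minus)
  then show ?thesis using pointed by simp
qed

lemma V_nonempty: "V \<noteq> {}"
proof
  assume "V = {}"
  \<comment> \<open>Without normals the cone would be the whole space, whose dimension is positive.\<close>
  then have "axis undefined 1 = (0 :: real ^ 'n)" by (intro eq_0_if_orthogonal) auto
  then show False by simp
qed

lemma normal_in_dual_cone: "u \<in> V \<Longrightarrow> u \<in> dual_cone C - {0}"
  using zero_V by (auto simp: dual_cone_def C_eq inner_commute)

lemma cone_le_iff: "cone_le C y z \<longleftrightarrow> (\<forall>u\<in>V. y \<bullet> u \<le> z \<bullet> u)"
  by (simp add: cone_le_def C_eq inner_diff_left)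

lemma interior_pos:
  assumes "z \<in> interior C" "u \<in> V"
  shows "0 < z \<bullet> u"
proof -
  obtain e where e: "e > 0" "cball z e \<subseteq> C"
    using assms(1) by (auto simp: mem_interior_cball)
  have u: "u \<noteq> 0" using assms(2) zero_V by auto
  \<comment> \<open>A step of length \<open>e\<close> against \<open>u\<close> strictly decreases the coordinate and stays in the cone.\<close>
  define y where "y = z - (e / norm u) *\<^sub>R u"
  have "y \<in> C" using e u by (intro subsetD[OF e(2)]) (auto simp: y_def dist_norm)
  then have "0 \<le> y \<bullet> u" using assms(2) by (simp add: C_eq)
  moreover have "0 < e / norm u * (u \<bullet> u)" using e u by simp
  ultimately show ?thesis by (simp add: y_def inner_diff_left)
qed

lemma interior_scaleR:
  assumes "z \<in> interior C" "c > 0"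
  shows "c *\<^sub>R z \<in> interior C"
proof -
  have "(*\<^sub>R) c ` C = C"
  proof
    show "(*\<^sub>R) c ` C \<subseteq> C" using assms(2) by (auto simp: C_eq)
    show "C \<subseteq> (*\<^sub>R) c ` C"
    proof
      fix y assume "y \<in> C"
      then have "(1 / c) *\<^sub>R y \<in> C" using assms(2) by (auto simp: C_eq)
      then show "y \<in> (*\<^sub>R) c ` C" using assms(2) by (intro image_eqI[of _ _ "(1 / c) *\<^sub>R y"]) auto
    qed
  qed
  moreover have "interior ((*\<^sub>R) c ` C) = (*\<^sub>R) c ` interior C"
    using assms(2) by (intro interior_injective_linear_image linear_scaleR) (simp add: inj_on_def)
  ultimately show ?thesis using assms(1) by auto
qed

lemma iterate_interior: "z \<in> interior C \<Longrightarrow> (f ^^ k) z \<in> interior C"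
  using maps by (induction k) auto

lemma iterate_le_scaleR:
  assumes yz: "y \<in> interior C" "z \<in> interior C" and c: "c > 0"
    and le: "cone_le C y (c *\<^sub>R z)"
  shows "cone_le C ((f ^^ k) y) (c *\<^sub>R (f ^^ k) z)"
proof (induction k)
  case (Suc k)
  let ?y = "(f ^^ k) y" and ?z = "(f ^^ k) z"
  have "?y \<in> interior C" "?z \<in> interior C" using yz by (auto intro: iterate_interior)
  then have "f (c *\<^sub>R ?z) = c *\<^sub>R f ?z" "cone_le C (f ?y) (f (c *\<^sub>R ?z))"
    using hom c monotone_onD[OF mono[unfolded cone_order_preserving_def] _ _ Suc.IH]
      interior_scaleR[of ?z c] by (auto simp: cone_homogeneous_def)
  then show ?case by simp
qed (use le in simp)

section \<open>Existence of the cone spectral radius\<close>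

text \<open>On the cone this linear functional is a substitute for the norm; being monotone and
  linear it interacts better with the order.\<close>

definition coord_sum :: "real ^ 'n \<Rightarrow> real" where
  "coord_sum z = (\<Sum>u\<in>V. z \<bullet> u)"

lemma inner_le_coord_sum:
  assumes "z \<in> C" "u \<in> V"
  shows "z \<bullet> u \<le> coord_sum z"
  unfolding coord_sum_def using assms finite_V by (intro member_le_sum) (auto simp: C_eq)

lemma coord_sum_pos: "z \<in> interior C \<Longrightarrow> 0 < coord_sum z"
  unfolding coord_sum_def using interior_pos finite_V V_nonempty by (intro sum_pos) auto

lemma coord_sum_mono: "cone_le C y (c *\<^sub>R z) \<Longrightarrow> coord_sum y \<le> c * coord_sum z"
  unfolding coord_sum_def sum_distrib_left by (intro sum_mono) (auto simp: cone_le_iff)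

text \<open>The sum of the absolute coordinates vanishes only at zero, so compactness of the unit
  sphere bounds it below by a multiple of the norm.\<close>

lemma norm_comparable_coord_sum:
  "\<exists>B>0. \<forall>z\<in>C. norm z \<le> B * coord_sum z \<and> coord_sum z \<le> B * norm z"
proof -
  define \<phi> where "\<phi> z = (\<Sum>u\<in>V. \<bar>z \<bullet> u\<bar>)" for z :: "real ^ 'n"
  have "continuous_on (sphere 0 1) \<phi>" unfolding \<phi>_def by (intro continuous_intros)
  moreover have "sphere (0 :: real ^ 'n) 1 \<noteq> {}" by simp
  ultimately obtain a where a: "norm a = 1" "\<And>z. norm z = 1 \<Longrightarrow> \<phi> a \<le> \<phi> z"
    using continuous_attains_inf[of "sphere 0 1" \<phi>] by auto
  have "\<phi> a \<noteq> 0"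
  proof
    assume "\<phi> a = 0"
    then have "\<forall>u\<in>V. a \<bullet> u = 0" using finite_V by (simp add: \<phi>_def sum_nonneg_eq_0_iff)
    then have "a = 0" by (intro eq_0_if_orthogonal) auto
    then show False using a(1) by simp
  qed
  moreover have "\<phi> a \<ge> 0" unfolding \<phi>_def by (intro sum_nonneg) auto
  ultimately have \<phi>a: "\<phi> a > 0" by simp
  have lower: "\<phi> a * norm z \<le> \<phi> z" for z
  proof (cases "z = 0")
    case False
    have "\<phi> ((1 / norm z) *\<^sub>R z) = \<phi> z / norm z"
      using False by (simp add: \<phi>_def abs_mult sum_divide_distrib)
    then have "\<phi> a \<le> \<phi> z / norm z" using a(2)[of "(1 / norm z) *\<^sub>R z"] False by simp
    then show ?thesis using False by (simp add: pos_le_divide_eq)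
  qed (simp add: \<phi>_def)
  define B where "B = 1 / \<phi> a + (\<Sum>u\<in>V. norm u)"
  have S: "(\<Sum>u\<in>V. norm u) \<ge> 0" by (intro sum_nonneg) auto
  have "norm z \<le> B * coord_sum z \<and> coord_sum z \<le> B * norm z" if z: "z \<in> C" for z
  proof
    have "\<phi> z = coord_sum z" unfolding \<phi>_def coord_sum_def using z by (intro sum.cong) (auto simp: C_eq)
    then have "norm z \<le> 1 / \<phi> a * coord_sum z" using lower[of z] \<phi>a by (simp add: field_simps)
    also have "\<dots> \<le> B * coord_sum z"
      using S z by (intro mult_right_mono) (auto simp: B_def coord_sum_def C_eq intro!: sum_nonneg)
    finally show "norm z \<le> B * coord_sum z" .
    have "coord_sum z \<le> (\<Sum>u\<in>V. norm u * norm z)"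
      unfolding coord_sum_def by (intro sum_mono) (metis norm_cauchy_schwarz mult.commute)
    also have "\<dots> \<le> B * norm z"
      unfolding sum_distrib_right[symmetric] using \<phi>a by (intro mult_right_mono) (auto simp: B_def)
    finally show "coord_sum z \<le> B * norm z" .
  qed
  moreover have "B > 0" using S \<phi>a by (simp add: B_def add_pos_nonneg)
  ultimately show ?thesis by blast
qed

text \<open>An interior point has only positive coordinates, and each coordinate of \<open>z\<close> is at most their
  sum. Hence every cone element lies below a multiple of the interior point that is controlled by
  the size of the element.\<close>

lemma order_unit:
  assumes x: "x \<in> interior C"
  shows "\<exists>K>0. \<forall>z\<in>C. cone_le C z ((K * coord_sum z) *\<^sub>R x)"
proof -
  define K where "K = (\<Sum>u\<in>V. 1 / (x \<bullet> u))"
  have p: "0 < x \<bullet> u" if "u \<in> V" for u using interior_pos[OF x that] .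
  have K: "K > 0" unfolding K_def using p finite_V V_nonempty by (intro sum_pos) auto
  have "z \<bullet> u \<le> (K * coord_sum z) * (x \<bullet> u)" if z: "z \<in> C" and u: "u \<in> V" for z u
  proof -
    have "1 / (x \<bullet> u) \<le> K"
      unfolding K_def using u p finite_V by (intro member_le_sum) (auto intro: less_imp_le)
    then have "1 \<le> K * (x \<bullet> u)" using p[OF u] by (simp add: field_simps)
    moreover have "z \<bullet> u \<le> coord_sum z" "0 \<le> z \<bullet> u"
      using inner_le_coord_sum[OF z u] z u by (auto simp: C_eq)
    ultimately have "z \<bullet> u * 1 \<le> coord_sum z * (K * (x \<bullet> u))" by (intro mult_mono) auto
    then show ?thesis by (simp add: ac_simps)
  qed
  then show ?thesis using K by (auto simp: cone_le_iff)
qed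

text \<open>Since \<open>f\<^sup>n x \<le> (K * coord_sum (f\<^sup>n x)) x\<close> for a constant \<open>K\<close>, the numbers
  \<open>K * coord_sum (f\<^sup>n x)\<close> are submultiplicative.\<close>

lemma coord_sum_growth_rate_exists:
  assumes x: "x \<in> interior C"
  shows "\<exists>r. (\<lambda>n. coord_sum ((f ^^ n) x) powr (1 / real n)) \<longlonglongrightarrow> r"
proof -
  obtain K where K: "K > 0" "\<And>z. z \<in> C \<Longrightarrow> cone_le C z ((K * coord_sum z) *\<^sub>R x)"
    using order_unit[OF x] by blast
  define b where "b n = K * coord_sum ((f ^^ n) x)" for n
  have it: "(f ^^ n) x \<in> interior C" for n using iterate_interior[OF x] .
  have pos: "b n > 0" for n unfolding b_def using K coord_sum_pos[OF it] by simp
  have "b (m + n) \<le> b m * b n" for m n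
  proof -
    have "cone_le C ((f ^^ n) x) (b n *\<^sub>R x)"
      unfolding b_def using it interior_subset by (intro K) blast
    then have "cone_le C ((f ^^ m) ((f ^^ n) x)) (b n *\<^sub>R (f ^^ m) x)"
      by (intro iterate_le_scaleR it x pos)
    then have "coord_sum ((f ^^ (m + n)) x) \<le> b n * coord_sum ((f ^^ m) x)"
      by (simp add: coord_sum_mono funpow_add)
    then show ?thesis using K(1) by (simp add: b_def mult_left_mono ac_simps)
  qed
  then obtain r where r: "(\<lambda>n. b n powr (1 / real n)) \<longlonglongrightarrow> r"
    using submultiplicative_growth_rate[of b] pos by blast
  have "(\<lambda>n. coord_sum ((f ^^ n) x) powr (1 / real n)) \<longlonglongrightarrow> r"
  proof (rule growth_rate_comparable[OF _ pos _ _ r])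
    fix n
    have t: "0 < coord_sum ((f ^^ n) x)" using coord_sum_pos[OF it] .
    show "0 < K + 1 / K" using K by (simp add: add_pos_pos)
    have "coord_sum ((f ^^ n) x) = 1 / K * b n" using K by (simp add: b_def)
    also have "\<dots> \<le> (K + 1 / K) * b n" using K pos[of n] by (intro mult_right_mono) auto
    finally show "coord_sum ((f ^^ n) x) \<le> (K + 1 / K) * b n" .
    show "b n \<le> (K + 1 / K) * coord_sum ((f ^^ n) x)"
      unfolding b_def using K t by (intro mult_right_mono) auto
  qed
  then show ?thesis by blast
qed

lemma iterates_comparable:
  assumes x: "x \<in> interior C" and y: "y \<in> interior C"
  shows "\<exists>B>0. \<forall>n. norm ((f ^^ n) y) \<le> B * coord_sum ((f ^^ n) x) \<and>
                   coord_sum ((f ^^ n) x) \<le> B * norm ((f ^^ n) y)"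
proof -
  have le: "\<exists>c>0. \<forall>n. coord_sum ((f ^^ n) y) \<le> c * coord_sum ((f ^^ n) z)"
    if y: "y \<in> interior C" and z: "z \<in> interior C" for y z
  proof -
    obtain K where K: "K > 0" "cone_le C y ((K * coord_sum y) *\<^sub>R z)"
      using order_unit[OF z] y interior_subset by blast
    have "coord_sum ((f ^^ n) y) \<le> (K * coord_sum y) * coord_sum ((f ^^ n) z)" for n
      using K coord_sum_pos[OF y] by (intro coord_sum_mono iterate_le_scaleR y z) auto
    then show ?thesis using K coord_sum_pos[OF y] by (intro exI[of _ "K * coord_sum y"]) auto
  qed
  obtain c d where cd: "c > 0" "\<And>n. coord_sum ((f ^^ n) y) \<le> c * coord_sum ((f ^^ n) x)"
    "d > 0" "\<And>n. coord_sum ((f ^^ n) x) \<le> d * coord_sum ((f ^^ n) y)"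
    using le[OF x y] le[OF y x] by blast
  obtain B where B: "B > 0" "\<And>z. z \<in> C \<Longrightarrow> norm z \<le> B * coord_sum z"
    "\<And>z. z \<in> C \<Longrightarrow> coord_sum z \<le> B * norm z"
    using norm_comparable_coord_sum by blast
  have "norm ((f ^^ n) y) \<le> (B * c + d * B) * coord_sum ((f ^^ n) x) \<and>
        coord_sum ((f ^^ n) x) \<le> (B * c + d * B) * norm ((f ^^ n) y)" for n
  proof
    have C: "(f ^^ n) y \<in> C" using iterate_interior[OF y] interior_subset by blast
    have "norm ((f ^^ n) y) \<le> B * coord_sum ((f ^^ n) y)" using B(2)[OF C] .
    also have "\<dots> \<le> B * (c * coord_sum ((f ^^ n) x))" using B(1) cd(2)[of n] by simp
    also have "\<dots> = (B * c) * coord_sum ((f ^^ n) x)" by simp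
    also have "\<dots> \<le> (B * c + d * B) * coord_sum ((f ^^ n) x)"
      using B(1) cd coord_sum_pos[OF iterate_interior[OF x]] by (intro mult_right_mono) (auto intro: less_imp_le)
    finally show "norm ((f ^^ n) y) \<le> (B * c + d * B) * coord_sum ((f ^^ n) x)" .
    have "coord_sum ((f ^^ n) x) \<le> d * coord_sum ((f ^^ n) y)" using cd(4) .
    also have "\<dots> \<le> d * (B * norm ((f ^^ n) y))" using B(3)[OF C] cd(3) by simp
    also have "\<dots> = (d * B) * norm ((f ^^ n) y)" by simp
    also have "\<dots> \<le> (B * c + d * B) * norm ((f ^^ n) y)"
      using B(1) cd by (intro mult_right_mono) auto
    finally show "coord_sum ((f ^^ n) x) \<le> (B * c + d * B) * norm ((f ^^ n) y)" .
  qed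
  moreover have "B * c + d * B > 0" using B cd by (simp add: add_pos_pos)
  ultimately show ?thesis by blast
qed

text \<open>The definite description that defines the spectral radius has a meaning because the rate
  exists for one orbit and, the orbits being comparable, is the same for all of them.\<close>

lemma norm_iterate_growth_rate:
  assumes x: "x \<in> interior C"
  shows "(\<lambda>k. norm ((f ^^ k) x) powr (1 / real k)) \<longlonglongrightarrow> cone_spectral_radius C f"
proof -
  obtain r where r: "(\<lambda>n. coord_sum ((f ^^ n) x) powr (1 / real n)) \<longlonglongrightarrow> r"
    using coord_sum_growth_rate_exists[OF x] by blast
  have lim: "(\<lambda>k. norm ((f ^^ k) y) powr (1 / real k)) \<longlonglongrightarrow> r" if y: "y \<in> interior C" for y
  proof -
    obtain B where B: "B > 0" "\<And>n. norm ((f ^^ n) y) \<le> B * coord_sum ((f ^^ n) x)"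
      "\<And>n. coord_sum ((f ^^ n) x) \<le> B * norm ((f ^^ n) y)"
      using iterates_comparable[OF x y] by blast
    show ?thesis
      using growth_rate_comparable[OF B(1) _ B(2,3) r] coord_sum_pos[OF iterate_interior[OF x]] .
  qed
  have "cone_spectral_radius C f = r"
    unfolding cone_spectral_radius_def
    by (rule the_equality) (use lim x LIMSEQ_unique[OF _ lim[OF x]] in blast)+
  then show ?thesis using lim[OF x] by simp
qed

lemma spectral_radius_nonneg:
  assumes "x \<in> interior C"
  shows "0 \<le> cone_spectral_radius C f"
  using norm_iterate_growth_rate[OF assms] by (rule LIMSEQ_le_const) auto

section \<open>A normal with controlled growth\<close>

definition min_ratio :: "real ^ 'n \<Rightarrow> nat \<Rightarrow> real" where
  "min_ratio x n = Min ((\<lambda>u. ((f ^^ n) x \<bullet> u) / (x \<bullet> u)) ` V)"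

lemma min_ratio_attained: "\<exists>u\<in>V. min_ratio x n = ((f ^^ n) x \<bullet> u) / (x \<bullet> u)"
proof -
  have "min_ratio x n \<in> (\<lambda>u. ((f ^^ n) x \<bullet> u) / (x \<bullet> u)) ` V"
    unfolding min_ratio_def using finite_V V_nonempty by (intro Min_in) auto
  then show ?thesis by auto
qed

lemma min_ratio_le: "u \<in> V \<Longrightarrow> min_ratio x n \<le> ((f ^^ n) x \<bullet> u) / (x \<bullet> u)"
  unfolding min_ratio_def using finite_V by simp

lemma min_ratio_pos:
  assumes "x \<in> interior C"
  shows "0 < min_ratio x n"
  using min_ratio_attained[of x n] interior_pos[OF assms] interior_pos[OF iterate_interior[OF assms]]
  by fastforce

lemma min_ratio_div_power_tendsto_0:
  assumes x: "x \<in> interior C" and R: "cone_spectral_radius C f < R"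
  shows "(\<lambda>n. min_ratio x n / R ^ n) \<longlonglongrightarrow> 0"
proof -
  obtain u where u: "u \<in> V" using V_nonempty by blast
  have R0: "R > 0" using spectral_radius_nonneg[OF x] R by simp
  have xu: "x \<bullet> u > 0" using interior_pos[OF x u] .
  show ?thesis
  proof (rule tendsto_sandwich)
    show "\<forall>\<^sub>F n in sequentially. 0 \<le> min_ratio x n / R ^ n"
      using min_ratio_pos[OF x] R0 by (intro always_eventually) (auto intro: less_imp_le)
    show "\<forall>\<^sub>F n in sequentially. min_ratio x n / R ^ n
        \<le> (norm u / (x \<bullet> u)) * (norm ((f ^^ n) x) / R ^ n)"
    proof (intro always_eventually allI)
      fix n
      have "min_ratio x n \<le> (norm ((f ^^ n) x) * norm u) / (x \<bullet> u)"
        using min_ratio_le[OF u, of x n] norm_cauchy_schwarz[of "(f ^^ n) x" u] xu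
        by (meson divide_right_mono less_imp_le order_trans)
      then have "min_ratio x n / R ^ n \<le> (norm ((f ^^ n) x) * norm u) / (x \<bullet> u) / R ^ n"
        using R0 by (intro divide_right_mono) auto
      then show "min_ratio x n / R ^ n \<le> (norm u / (x \<bullet> u)) * (norm ((f ^^ n) x) / R ^ n)"
        by (simp add: ac_simps)
    qed
    show "(\<lambda>n. (norm u / (x \<bullet> u)) * (norm ((f ^^ n) x) / R ^ n)) \<longlonglongrightarrow> 0"
      by (intro tendsto_mult_right_zero growth_rate_below_ratio_tendsto_0[OF _
            norm_iterate_growth_rate[OF x] spectral_radius_nonneg[OF x] R]) auto
  qed simp
qed

text \<open>Applying \<open>f\<^sup>k\<close> to \<open>min_ratio x (n - k) x \<le> f\<^sup>n\<^sup>-\<^sup>k x\<close> bounds \<open>f\<^sup>k x\<close> by a multiple of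
  \<open>f\<^sup>n x\<close>; at a normal attaining the minimum the latter is known exactly.\<close>

lemma iterate_at_minimiser:
  assumes x: "x \<in> interior C" and u: "u \<in> V"
    and min: "min_ratio x n = ((f ^^ n) x \<bullet> u) / (x \<bullet> u)" and k: "k \<le> n"
  shows "(f ^^ k) x \<bullet> u \<le> min_ratio x n / min_ratio x (n - k) * (x \<bullet> u)"
proof -
  let ?m = "min_ratio x (n - k)"
  have m: "?m > 0" using min_ratio_pos[OF x] .
  have "x \<bullet> v \<le> 1 / ?m * ((f ^^ (n - k)) x \<bullet> v)" if v: "v \<in> V" for v
    using min_ratio_le[OF v, of x "n - k"] interior_pos[OF x v] m by (simp add: field_simps)
  then have "cone_le C x ((1 / ?m) *\<^sub>R (f ^^ (n - k)) x)"
    by (simp add: cone_le_iff)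
  then have "cone_le C ((f ^^ k) x) ((1 / ?m) *\<^sub>R (f ^^ k) ((f ^^ (n - k)) x))"
    using m by (intro iterate_le_scaleR x iterate_interior) auto
  moreover have "(f ^^ k) ((f ^^ (n - k)) x) = (f ^^ n) x"
    using k by (simp flip: funpow_add[THEN fun_cong, unfolded comp_def])
  ultimately have "(f ^^ k) x \<bullet> u \<le> 1 / ?m * ((f ^^ n) x \<bullet> u)"
    using u by (simp add: cone_le_iff)
  also have "(f ^^ n) x \<bullet> u = min_ratio x n * (x \<bullet> u)"
    using min interior_pos[OF x u] by simp
  finally show ?thesis by simp
qed

text \<open>If every normal failed at some exponent \<open>\<kappa> u\<close>, then, \<open>V\<close> being finite, all of them would
  still fail there with a common rate \<open>R\<close> slightly above the spectral radius. A record low of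
  \<open>min_ratio x n / R ^ n\<close> with \<open>n\<close> beyond all these exponents contradicts this at a normal that
  attains the minimum.\<close>

lemma normal_with_bounded_growth:
  assumes x: "x \<in> interior C"
  shows "\<exists>u\<in>V. \<forall>k. (f ^^ k) x \<bullet> u \<le> cone_spectral_radius C f ^ k * (x \<bullet> u)"
proof (rule ccontr)
  let ?\<rho> = "cone_spectral_radius C f"
  assume "\<not> ?thesis"
  then have "\<forall>u\<in>V. \<exists>k. ?\<rho> ^ k * (x \<bullet> u) < (f ^^ k) x \<bullet> u" by (simp add: not_le)
  then obtain \<kappa> where \<kappa>: "\<And>u. u \<in> V \<Longrightarrow> ?\<rho> ^ \<kappa> u * (x \<bullet> u) < (f ^^ \<kappa> u) x \<bullet> u"
    by metis
  have "\<forall>\<^sub>F R in at_right ?\<rho>. R ^ \<kappa> u * (x \<bullet> u) < (f ^^ \<kappa> u) x \<bullet> u" if "u \<in> V" for u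
  proof (rule order_tendstoD(2)[OF _ \<kappa>[OF that]])
    show "((\<lambda>R. R ^ \<kappa> u * (x \<bullet> u)) \<longlongrightarrow> ?\<rho> ^ \<kappa> u * (x \<bullet> u)) (at_right ?\<rho>)"
      by (intro tendsto_intros)
  qed
  then have "\<forall>\<^sub>F R in at_right ?\<rho>. \<forall>u\<in>V. R ^ \<kappa> u * (x \<bullet> u) < (f ^^ \<kappa> u) x \<bullet> u"
    using finite_V by (simp add: eventually_ball_finite)
  then have "\<forall>\<^sub>F R in at_right ?\<rho>. ?\<rho> < R \<and> (\<forall>u\<in>V. R ^ \<kappa> u * (x \<bullet> u) < (f ^^ \<kappa> u) x \<bullet> u)"
    using eventually_at_right_less[of ?\<rho>] by eventually_elim auto
  then obtain R where R: "?\<rho> < R" "\<And>u. u \<in> V \<Longrightarrow> R ^ \<kappa> u * (x \<bullet> u) < (f ^^ \<kappa> u) x \<bullet> u"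
    using eventually_happens'[OF trivial_limit_at_right_real] by blast
  have R0: "R > 0" using spectral_radius_nonneg[OF x] R(1) by simp
  obtain n where n: "n \<ge> Max (\<kappa> ` V)"
    "\<And>j. j \<le> n \<Longrightarrow> min_ratio x n / R ^ n \<le> min_ratio x j / R ^ j"
    using record_low_exists[OF _ min_ratio_div_power_tendsto_0[OF x R(1)], of "Max (\<kappa> ` V)"]
      min_ratio_pos[OF x] R0 by auto
  obtain u where u: "u \<in> V" "min_ratio x n = ((f ^^ n) x \<bullet> u) / (x \<bullet> u)"
    using min_ratio_attained by blast
  let ?k = "\<kappa> u"
  have k: "?k \<le> n" using n(1) u(1) finite_V by (meson Max_ge finite_imageI imageI order_trans)
  have "min_ratio x n / min_ratio x (n - ?k) \<le> R ^ n / R ^ (n - ?k)"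
    using n(2)[of "n - ?k"] min_ratio_pos[OF x] R0 by (simp add: field_simps)
  also have "\<dots> = R ^ ?k" using k R0 by (simp add: power_diff)
  finally have "min_ratio x n / min_ratio x (n - ?k) * (x \<bullet> u) \<le> R ^ ?k * (x \<bullet> u)"
    using interior_pos[OF x u(1)] by (intro mult_right_mono) auto
  then show False using iterate_at_minimiser[OF x u k] R(2)[OF u(1)] by linarith
qed

end

theorem theorem3:
  fixes C :: "(real ^ 'n) set"
    and f :: "real ^ 'n \<Rightarrow> real ^ 'n"
    and \<rho> :: real
    and x :: "real ^ 'n"
  assumes "proper_closed_cone C"
    and "f ` interior C \<subseteq> interior C"
    and "cone_order_preserving C f"
    and "cone_homogeneous C f"
    and "cone_spectral_radius C f = \<rho>"
    and "polyhedral_cone C"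
    and "x \<in> interior C"
  shows "\<exists>w \<in> dual_cone C - {0}. \<forall>k::nat. (f ^^ k) x \<bullet> w \<le> \<rho> ^ k * (x \<bullet> w)"
proof -
  obtain U where U: "finite U" "C = (\<Inter>u\<in>U. {x. x \<bullet> u \<ge> 0})"
    and pointed: "C \<inter> uminus ` C = {0}"
    using assms(6) by (auto simp: polyhedral_cone_def closed_cone_def)
  have "C = {z. \<forall>u\<in>U - {0}. 0 \<le> z \<bullet> u}" unfolding U(2) by force
  then interpret polyhedral_order_map C "U - {0}" f
    using U(1) pointed assms(2-4) by unfold_locales auto
  obtain u where "u \<in> U - {0}" "\<And>k. (f ^^ k) x \<bullet> u \<le> \<rho> ^ k * (x \<bullet> u)"
    using normal_with_bounded_growth[OF assms(7)] assms(5) by blast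
  then show ?thesis using normal_in_dual_cone by blast
qed

end
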